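(* Let $S=\Bbbk[x_0,x_1,x_2,\ldots,x_n]$, let $I\subseteq S$ be a squarefree monomial ideal, and let $J\subseteq S$ be its Alexander dual. Let $S_1=\Bbbk[x,x_2,\ldots,x_n]$ and let $S\to S_1$ be the $\Bbbk$-algebra map given by $x_i\mapsto x_i$ for $i\ge2$ and $x_0,x_1\mapsto x$. Let $I_1$ and $J_1$ be the ideals of $S_1$ which are the images of $I$ and $J$ respectively. a) If $x_1-x_0$ is a regular element of $S/I$, then $J_1$ is squarefree. b) If $I_1$ is squarefree, then $x_1-x_0$ is a regular element on $S/J$. c) If both $x_1-x_0$ is a regular element on $S/I$ and $I_1$ is squarefree, then $J_1$ is the Alexander dual of $I_1$.
   Context: $\Bbbk$ is a field. A squarefree monomial ideal is one generated by squarefree monomials. The Alexander dual of a squarefree monomial ideal $I$ in a polynomial ring is the monomial ideal of that ring whose monomials are those having a nontrivial common divisor with every monomial in $I$. A regular element means a nonzerodivisor. *)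

theory Defs
  imports "HOL-Library.Poly_Mapping" "HOL-Algebra.QuotRing" "HOL-Algebra.Divisibility"
begin

text \<open>Polynomials in variables indexed by the natural numbers: an exponent vector is a finitely
  supported function \<^typ>\<open>nat \<Rightarrow>\<^sub>0 nat\<close>, and a polynomial is a finitely supported family of
  coefficients indexed by exponent vectors, with the convolution product of
  \<^theory>\<open>HOL-Library.Poly_Mapping\<close>.\<close>

type_synonym 'k mpoly = "(nat \<Rightarrow>\<^sub>0 nat) \<Rightarrow>\<^sub>0 'k"

definition Var :: "nat \<Rightarrow> 'k::field mpoly"
  where "Var i = Poly_Mapping.single (Poly_Mapping.single i 1) 1"

definition Const :: "'k \<Rightarrow> 'k::field mpoly"
  where "Const c = Poly_Mapping.single 0 c"

definition mon :: "(nat \<Rightarrow>\<^sub>0 nat) \<Rightarrow> 'k::field mpoly"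
  where "mon m = Poly_Mapping.single m 1"

text \<open>The polynomial ring over \<open>'k\<close> whose variables are the \<^term>\<open>Var i\<close> with \<^term>\<open>i \<in> V\<close>.\<close>

definition mpoly_ring :: "nat set \<Rightarrow> 'k::field mpoly ring"
  where "mpoly_ring V =
    \<lparr>carrier = {p. \<forall>m\<in>Poly_Mapping.keys p. Poly_Mapping.keys m \<subseteq> V},
     monoid.mult = (*), one = 1, zero = 0, add = (+)\<rparr>"

definition monomials :: "nat set \<Rightarrow> 'k::field mpoly set"
  where "monomials V = {mon m |m. Poly_Mapping.keys m \<subseteq> V}"

definition squarefree_monomials :: "nat set \<Rightarrow> 'k::field mpoly set"
  where "squarefree_monomials V =
    {mon m |m. Poly_Mapping.keys m \<subseteq> V \<and> (\<forall>i. Poly_Mapping.lookup m i \<le> 1)}"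

text \<open>The empty generating set is allowed, so the zero ideal is squarefree; so is the unit ideal,
  generated by the empty product.\<close>

definition squarefree_monomial_ideal :: "nat set \<Rightarrow> 'k::field mpoly set \<Rightarrow> bool"
  where "squarefree_monomial_ideal V I \<longleftrightarrow>
    (\<exists>M \<subseteq> squarefree_monomials V. I = genideal (mpoly_ring V) M)"

definition nontrivial_common_divisor :: "nat set \<Rightarrow> 'k::field mpoly \<Rightarrow> 'k mpoly \<Rightarrow> bool"
  where "nontrivial_common_divisor V p q \<longleftrightarrow>
    (\<exists>d \<in> carrier (mpoly_ring V). d \<notin> Units (mpoly_ring V) \<and>
       d divides\<^bsub>mpoly_ring V\<^esub> p \<and> d divides\<^bsub>mpoly_ring V\<^esub> q)"

text \<open>The generating set below is closed under multiplication by monomials, so it consists of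
  exactly the monomials of the ideal it generates.\<close>

definition alexander_dual :: "nat set \<Rightarrow> 'k::field mpoly set \<Rightarrow> 'k mpoly set"
  where "alexander_dual V I = genideal (mpoly_ring V)
    {p \<in> monomials V. \<forall>q \<in> monomials V \<inter> I. nontrivial_common_divisor V p q}"

text \<open>With this definition every element of the zero ring is regular.\<close>

definition regular_element :: "('a, 'b) ring_scheme \<Rightarrow> 'a \<Rightarrow> bool"
  where "regular_element R a \<longleftrightarrow>
    a \<in> carrier R \<and> (\<forall>b \<in> carrier R. a \<otimes>\<^bsub>R\<^esub> b = \<zero>\<^bsub>R\<^esub> \<longrightarrow> b = \<zero>\<^bsub>R\<^esub>)"

text \<open>The \<open>'k\<close>-algebra map sending \<^term>\<open>Var i\<close> to \<open>\<sigma> i\<close>.\<close>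

definition mpoly_subst :: "(nat \<Rightarrow> 'k mpoly) \<Rightarrow> 'k::field mpoly \<Rightarrow> 'k mpoly"
  where "mpoly_subst \<sigma> p =
    (\<Sum>m\<in>Poly_Mapping.keys p. Const (Poly_Mapping.lookup p m) *
       (\<Prod>i\<in>Poly_Mapping.keys m. \<sigma> i ^ Poly_Mapping.lookup m i))"

text \<open>The target \<open>k[x, x\<^sub>2, \<dots>, x\<^sub>n]\<close> of the map identifying \<open>x\<^sub>0\<close> and \<open>x\<^sub>1\<close> is realised as
  \<^term>\<open>mpoly_ring {1..n}\<close>: the new variable \<open>x\<close> is \<^term>\<open>Var 1\<close> of that ring.\<close>

definition identify01 :: "'k::field mpoly \<Rightarrow> 'k mpoly"
  where "identify01 = mpoly_subst (\<lambda>i. if i \<le> 1 then Var 1 else Var i)"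

end

theory Submission
  imports Defs
begin

text \<open>Membership of a monomial in a squarefree monomial ideal depends only on its support, so such an
  ideal is the same thing as an upward closed family \<open>F\<close> of subsets of the variables
  (\<open>squarefree_monomial_ideal_iff\<close>). Two monomials have a nontrivial common divisor exactly when
  their supports meet; hence the Alexander dual of the ideal of \<open>F\<close> is the ideal of the family
  \<open>F\<^sup>*\<close> of those sets whose complement is not in \<open>F\<close> (\<open>alexander_dual_support_ideal\<close>).

  Both algebraic conditions then become combinatorial.

  \<^item> The associated primes of a squarefree monomial ideal are generated by the complements of
    the facets, the maximal sets outside \<open>F\<close>. So \<open>x\<^sub>1 - x\<^sub>0\<close> is regular modulo the ideal iff every
    facet contains \<open>0\<close> or \<open>1\<close>, that is, iff \<open>C \<union> {0} \<in> F\<close> and \<open>C \<union> {1} \<in> F\<close> imply \<open>C \<in> F\<close>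
    (\<open>regular_difference_iff_facets_meet\<close>; the proof there looks at terms of extreme degree
    instead of primes).

  \<^item> Identifying \<open>x\<^sub>0\<close> with \<open>x\<^sub>1\<close> turns a squarefree generator into a nonsquarefree one exactly
    if it involves both variables. So the image of the ideal is squarefree iff no minimal member
    of \<open>F\<close> contains both \<open>0\<close> and \<open>1\<close>, that is, iff \<open>A \<in> F\<close> implies \<open>A - {0} \<in> F\<close> or
    \<open>A - {1} \<in> F\<close> (\<open>squarefree_image_iff_generators_omit\<close>).

  Taking complements exchanges the two conditions on \<open>F\<close> and \<open>F\<^sup>*\<close>
  (\<open>facets_meet_dual_family_iff\<close>, \<open>generators_omit_dual_family_iff\<close>), which gives a) and b), even as
  equivalences. If both conditions hold for \<open>F\<close>, then both images are described by families on the
  smaller set of variables, and c) is the statement that passing to these families commutes with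
  \<open>F \<mapsto> F\<^sup>*\<close> (\<open>collapse_dual_family\<close>).\<close>

section \<open>Families of supports\<close>

definition up_closed :: "'a set \<Rightarrow> 'a set set \<Rightarrow> bool"
  where "up_closed V F \<longleftrightarrow> F \<subseteq> Pow V \<and> (\<forall>A\<in>F. \<forall>B. A \<subseteq> B \<longrightarrow> B \<subseteq> V \<longrightarrow> B \<in> F)"

definition dual_family :: "'a set \<Rightarrow> 'a set set \<Rightarrow> 'a set set"
  where "dual_family V F = {B. B \<subseteq> V \<and> V - B \<notin> F}"

text \<open>For an upward closed family \<open>F\<close> of subsets of a finite set \<open>V\<close> containing \<open>a\<close> and \<open>b\<close>, this
  says that every maximal nonmember of \<open>F\<close> among the subsets of \<open>V\<close> contains \<open>a\<close> or \<open>b\<close>: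
  a nonmember \<open>C\<close> can be enlarged by one of the two and stay a nonmember. Nonmembers are the faces
  of the Stanley--Reisner complex, hence the name. Sets \<open>C\<close> that already contain \<open>a\<close> or \<open>b\<close>
  satisfy the condition trivially.\<close>
definition facets_meet :: "'a \<Rightarrow> 'a \<Rightarrow> 'a set set \<Rightarrow> bool"
  where "facets_meet a b F \<longleftrightarrow> (\<forall>C. insert a C \<in> F \<longrightarrow> insert b C \<in> F \<longrightarrow> C \<in> F)"

text \<open>For an upward closed family \<open>F\<close> on a finite set this says that no minimal member of \<open>F\<close>, that is, no minimal
  generator of the ideal, contains both \<open>a\<close> and \<open>b\<close>.\<close>
definition generators_omit :: "'a \<Rightarrow> 'a \<Rightarrow> 'a set set \<Rightarrow> bool"
  where "generators_omit a b F \<longleftrightarrow> (\<forall>A\<in>F. A - {a} \<in> F \<or> A - {b} \<in> F)"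

lemma up_closedD: "up_closed V F \<Longrightarrow> A \<in> F \<Longrightarrow> A \<subseteq> B \<Longrightarrow> B \<subseteq> V \<Longrightarrow> B \<in> F"
  by (auto simp: up_closed_def)

lemma up_closed_subset: "up_closed V F \<Longrightarrow> A \<in> F \<Longrightarrow> A \<subseteq> V"
  by (auto simp: up_closed_def)

lemma up_closed_dual_family:
  assumes "up_closed V F"
  shows "up_closed V (dual_family V F)"
  unfolding up_closed_def dual_family_def
proof safe
  fix A B assume "V - A \<notin> F" "A \<subseteq> B" "V - B \<in> F"
  then show False using up_closedD[OF assms, of "V - B" "V - A"] by blast
qed blast

lemma dual_family_dual_family:
  assumes "up_closed V F"
  shows "dual_family V (dual_family V F) = F"
proof -
  have "V - (V - A) = A" if "A \<subseteq> V" for A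
    using that by blast
  then show ?thesis
    using up_closed_subset[OF assms] unfolding dual_family_def by auto
qed

text \<open>Put \<open>C = V - A\<close>: adding \<open>a\<close> or \<open>b\<close> to \<open>C\<close> is removing it from \<open>A\<close>, and membership of \<open>C\<close>
  in the dual family is nonmembership of \<open>A\<close> in \<open>F\<close>.\<close>

lemma facets_meet_dual_family_iff:
  assumes F: "up_closed V F" and ab: "a \<in> V" "b \<in> V"
  shows "facets_meet a b (dual_family V F) \<longleftrightarrow> generators_omit a b F"
proof
  assume L: "facets_meet a b (dual_family V F)"
  show "generators_omit a b F"
    unfolding generators_omit_def
  proof
    fix A assume A: "A \<in> F"
    then have "A \<subseteq> V" using F by (rule up_closed_subset[rotated])
    then have "V - insert a (V - A) = A - {a}" "V - insert b (V - A) = A - {b}" "V - (V - A) = A"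
      by auto
    then show "A - {a} \<in> F \<or> A - {b} \<in> F"
      using L[unfolded facets_meet_def, rule_format, of "V - A"] A ab
      by (auto simp: dual_family_def)
  qed
next
  assume R: "generators_omit a b F"
  show "facets_meet a b (dual_family V F)"
    unfolding facets_meet_def
  proof (intro allI impI)
    fix C assume C: "insert a C \<in> dual_family V F" "insert b C \<in> dual_family V F"
    have "V - insert a C = (V - C) - {a}" "V - insert b C = (V - C) - {b}"
      by auto
    then show "C \<in> dual_family V F"
      using C R by (auto simp: dual_family_def generators_omit_def)
  qed
qed

lemma generators_omit_dual_family_iff:
  assumes F: "up_closed V F" and ab: "a \<in> V" "b \<in> V"
  shows "generators_omit a b (dual_family V F) \<longleftrightarrow> facets_meet a b F"
  using facets_meet_dual_family_iff[OF up_closed_dual_family[OF F] ab]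
  by (simp add: dual_family_dual_family[OF F])

section \<open>Monomials and the polynomial ring\<close>

text \<open>A finitely supported function is the sum of its terms, so an additive property need only be
  checked on the terms supported at its keys.\<close>

lemma poly_mapping_span_induct:
  fixes p :: "'a \<Rightarrow>\<^sub>0 'b::comm_monoid_add"
  assumes "\<And>m c. m \<in> Poly_Mapping.keys p \<Longrightarrow> P (Poly_Mapping.single m c)"
    and "P 0" and "\<And>x y. P x \<Longrightarrow> P y \<Longrightarrow> P (x + y)"
  shows "P p"
proof -
  have "P (\<Sum>m\<in>A. Poly_Mapping.single m (Poly_Mapping.lookup p m))"
    if "finite A" "A \<subseteq> Poly_Mapping.keys p" for A
    using that by (induction A) (auto intro: assms)
  moreover have "(\<Sum>m\<in>Poly_Mapping.keys p. Poly_Mapping.single m (Poly_Mapping.lookup p m)) = p"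
    by (rule poly_mapping_eqI)
      (auto simp: lookup_sum lookup_single when_def in_keys_iff)
  ultimately show ?thesis
    by (metis finite_keys order_refl)
qed

lemma keys_add_exponent:
  fixes u v :: "'a \<Rightarrow>\<^sub>0 nat"
  shows "Poly_Mapping.keys (u + v) = Poly_Mapping.keys u \<union> Poly_Mapping.keys v"
  by (auto simp: in_keys_iff lookup_add)

lemma keys_mon [simp]: "Poly_Mapping.keys (mon m :: 'k::field mpoly) = {m}"
  by (simp add: mon_def)

lemma Var_eq_mon: "Var i = mon (Poly_Mapping.single i 1)"
  by (simp add: Var_def mon_def)

lemma mon_in_carrier_iff:
  "(mon m :: 'k::field mpoly) \<in> carrier (mpoly_ring V) \<longleftrightarrow> Poly_Mapping.keys m \<subseteq> V"
  by (simp add: mpoly_ring_def)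

lemma lookup_mon_times:
  fixes f :: "'k::field mpoly"
  shows "Poly_Mapping.lookup (mon u * f) (u + m) = Poly_Mapping.lookup f m"
  by (simp add: mon_def lookup_mult lookup_single when_mult)

lemma keys_mon_times:
  fixes f :: "'k::field mpoly"
  shows "Poly_Mapping.keys (mon u * f) = (+) u ` Poly_Mapping.keys f"
proof
  show "Poly_Mapping.keys (mon u * f) \<subseteq> (+) u ` Poly_Mapping.keys f"
    using keys_mult[of "mon u" f] by auto
  show "(+) u ` Poly_Mapping.keys f \<subseteq> Poly_Mapping.keys (mon u * f)"
    by (auto simp: in_keys_iff lookup_mon_times)
qed

lemma keys_timesE:
  fixes p q :: "'k::field mpoly"
  assumes "m \<in> Poly_Mapping.keys (p * q)"
  obtains k l where "k \<in> Poly_Mapping.keys p" "l \<in> Poly_Mapping.keys q" "m = k + l"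
  using assms keys_mult[of p q] by blast

lemma mpoly_ring_mult_closed:
  fixes p q :: "'k::field mpoly"
  assumes "p \<in> carrier (mpoly_ring V)" "q \<in> carrier (mpoly_ring V)"
  shows "p * q \<in> carrier (mpoly_ring V)"
proof -
  have "Poly_Mapping.keys m \<subseteq> V" if m: "m \<in> Poly_Mapping.keys (p * q)" for m
  proof -
    obtain k l where "k \<in> Poly_Mapping.keys p" "l \<in> Poly_Mapping.keys q" "m = k + l"
      by (rule keys_timesE[OF m])
    then show ?thesis
      using assms by (simp add: mpoly_ring_def keys_add_exponent)
  qed
  then show ?thesis by (simp add: mpoly_ring_def)
qed

lemma mpoly_ring_mult: "p \<otimes>\<^bsub>mpoly_ring V\<^esub> q = p * q"
  by (simp add: mpoly_ring_def)

lemma cring_mpoly_ring: "cring (mpoly_ring V :: 'k::field mpoly ring)"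
proof (rule cringI)
  show "abelian_group (mpoly_ring V :: 'k mpoly ring)"
  proof (rule abelian_groupI, goal_cases)
    case (1 x y)
    then show ?case
      using Poly_Mapping.keys_add[of x y] by (fastforce simp: mpoly_ring_def)
  next
    case (6 x)
    then show ?case
      by (intro bexI[of _ "- x"]) (auto simp: mpoly_ring_def in_keys_iff)
  qed (auto simp: mpoly_ring_def)
next
  show "comm_monoid (mpoly_ring V :: 'k mpoly ring)"
  proof (rule comm_monoidI, goal_cases)
    case (1 x y)
    then show ?case
      using mpoly_ring_mult_closed[of x V y] by (simp add: mpoly_ring_def)
  qed (auto simp: mpoly_ring_def mult_ac)
qed (auto simp: mpoly_ring_def algebra_simps)

lemma mpoly_ring_minus_closed:
  assumes "p \<in> carrier (mpoly_ring V)" "q \<in> carrier (mpoly_ring V)"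
  shows "p - q \<in> carrier (mpoly_ring V :: 'k::field mpoly ring)"
  using assms keys_diff[of p q] by (auto simp: mpoly_ring_def)

lemma Var_in_carrier: "i \<in> V \<Longrightarrow> (Var i :: 'k::field mpoly) \<in> carrier (mpoly_ring V)"
  by (simp add: Var_eq_mon mon_in_carrier_iff)

text \<open>A polynomial lies in a monomial ideal iff each of its terms is divisible by a generator: the
  polynomials with this property already form an ideal, since every term of a product is a multiple
  of a term of the second factor. Divisibility of monomials is written as \<open>m = u + v\<close> for exponents.\<close>

lemma genideal_monomials:
  fixes V :: "nat set"
  assumes U: "\<And>u. u \<in> U \<Longrightarrow> Poly_Mapping.keys u \<subseteq> V"
  shows "genideal (mpoly_ring V) (mon ` U) =
    {p :: 'k::field mpoly. \<forall>m\<in>Poly_Mapping.keys p.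
       Poly_Mapping.keys m \<subseteq> V \<and> (\<exists>u\<in>U. \<exists>v. m = u + v)}"
    (is "_ = ?K")
proof
  interpret cring "mpoly_ring V :: 'k mpoly ring" by (rule cring_mpoly_ring)
  have carrier: "x \<in> carrier (mpoly_ring V)" if "x \<in> ?K" for x :: "'k mpoly"
    using that by (simp add: mpoly_ring_def)
  have closed: "x * a \<in> ?K" if a: "a \<in> ?K" and x: "x \<in> carrier (mpoly_ring V)" for a x :: "'k mpoly"
  proof (intro CollectI ballI conjI)
    fix m assume m: "m \<in> Poly_Mapping.keys (x * a)"
    show "Poly_Mapping.keys m \<subseteq> V"
      using mpoly_ring_mult_closed[OF x carrier[OF a]] m by (simp add: mpoly_ring_def)
    obtain k l where kl: "k \<in> Poly_Mapping.keys x" "l \<in> Poly_Mapping.keys a" "m = k + l"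
      by (rule keys_timesE[OF m])
    obtain u v where "u \<in> U" "l = u + v" using kl(2) a by blast
    then show "\<exists>u\<in>U. \<exists>v. m = u + v"
      using kl(3) by (intro bexI[of _ u] exI[of _ "k + v"]) (simp_all add: add_ac)
  qed
  have add: "x + y \<in> ?K" if "x \<in> ?K" "y \<in> ?K" for x y :: "'k mpoly"
    using that Poly_Mapping.keys_add[of x y] by fastforce
  have "ideal ?K (mpoly_ring V :: 'k mpoly ring)"
  proof (rule idealI[OF ring_axioms])
    show "subgroup ?K (add_monoid (mpoly_ring V :: 'k mpoly ring))"
    proof (rule add.subgroupI)
      show "?K \<subseteq> carrier (mpoly_ring V)" using carrier by blast
      have "0 \<in> ?K" by simp
      then show "?K \<noteq> {}" by blast
    next
      fix a :: "'k mpoly" assume a: "a \<in> ?K"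
      then have ac: "a \<in> carrier (mpoly_ring V)" by (rule carrier)
      have "\<ominus>\<^bsub>mpoly_ring V\<^esub> a = - a"
        by (rule minus_equality)
          (use ac in \<open>auto simp: mpoly_ring_def in_keys_iff\<close>)
      moreover have "- a \<in> ?K" using a by (auto simp: in_keys_iff)
      ultimately show "\<ominus>\<^bsub>mpoly_ring V\<^esub> a \<in> ?K" by simp
    next
      fix a b :: "'k mpoly" assume "a \<in> ?K" "b \<in> ?K"
      then show "a \<oplus>\<^bsub>mpoly_ring V\<^esub> b \<in> ?K"
        using add[of a b] by (simp add: mpoly_ring_def)
    qed
  next
    fix a x :: "'k mpoly"
    assume "a \<in> ?K" "x \<in> carrier (mpoly_ring V)"
    then have "x * a \<in> ?K" by (rule closed)
    then show "x \<otimes>\<^bsub>mpoly_ring V\<^esub> a \<in> ?K" "a \<otimes>\<^bsub>mpoly_ring V\<^esub> x \<in> ?K"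
      by (simp_all only: mpoly_ring_mult mult.commute[of a x])
  qed
  moreover have "mon ` U \<subseteq> ?K"
  proof
    fix p :: "'k mpoly" assume "p \<in> mon ` U"
    then obtain u where u: "u \<in> U" "p = mon u" by blast
    then have "\<exists>u'\<in>U. \<exists>v. u = u' + v"
      by (intro bexI[of _ u] exI[of _ 0]) simp_all
    then show "p \<in> ?K" using u(2) U[OF u(1)] by simp
  qed
  ultimately show "genideal (mpoly_ring V) (mon ` U) \<subseteq> ?K"
    by (rule genideal_minimal)

  have MU: "(mon ` U :: 'k mpoly set) \<subseteq> carrier (mpoly_ring V)"
    using U by (auto simp: mon_in_carrier_iff)
  interpret G: ideal "genideal (mpoly_ring V) (mon ` U :: 'k mpoly set)" "mpoly_ring V"
    using MU by (rule genideal_ideal)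
  show "?K \<subseteq> genideal (mpoly_ring V) (mon ` U)"
  proof
    fix p :: "'k mpoly" assume p: "p \<in> ?K"
    show "p \<in> genideal (mpoly_ring V) (mon ` U)"
    proof (rule poly_mapping_span_induct)
      fix m and c :: 'k assume m: "m \<in> Poly_Mapping.keys p"
      then obtain u v where uv: "u \<in> U" "m = u + v" "Poly_Mapping.keys m \<subseteq> V" using p by blast
      have "mon u \<in> genideal (mpoly_ring V) (mon ` U :: 'k mpoly set)"
        using genideal_self[OF MU] uv by blast
      moreover have "Poly_Mapping.single v c \<in> carrier (mpoly_ring V)"
        using uv by (auto simp: mpoly_ring_def keys_add_exponent)
      ultimately have "Poly_Mapping.single v c \<otimes>\<^bsub>mpoly_ring V\<^esub> mon u
          \<in> genideal (mpoly_ring V) (mon ` U)"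
        by (rule G.I_l_closed)
      then show "Poly_Mapping.single m c \<in> genideal (mpoly_ring V) (mon ` U)"
        using uv by (simp add: mpoly_ring_def mon_def mult_single add_ac)
    next
      show "0 \<in> genideal (mpoly_ring V) (mon ` U :: 'k mpoly set)"
        using G.zero_closed by (simp add: mpoly_ring_def)
    next
      fix x y :: "'k mpoly"
      assume "x \<in> genideal (mpoly_ring V) (mon ` U)" "y \<in> genideal (mpoly_ring V) (mon ` U)"
      then show "x + y \<in> genideal (mpoly_ring V) (mon ` U)"
        using G.a_closed[of x y] by (simp add: mpoly_ring_def)
    qed
  qed
qed

section \<open>Squarefree monomial ideals as families of supports\<close>

definition support_ideal :: "nat set set \<Rightarrow> 'k::field mpoly set"
  where "support_ideal F = {p. \<forall>m\<in>Poly_Mapping.keys p. Poly_Mapping.keys m \<in> F}"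

definition squarefree_exponent :: "nat set \<Rightarrow> (nat \<Rightarrow>\<^sub>0 nat)"
  where "squarefree_exponent A = (\<Sum>i\<in>A. Poly_Mapping.single i 1)"

lemma lookup_squarefree_exponent:
  "finite A \<Longrightarrow> Poly_Mapping.lookup (squarefree_exponent A) i = (if i \<in> A then 1 else 0)"
  by (simp add: squarefree_exponent_def lookup_sum lookup_single when_def)

lemma keys_squarefree_exponent: "finite A \<Longrightarrow> Poly_Mapping.keys (squarefree_exponent A) = A"
  by (auto simp: in_keys_iff lookup_squarefree_exponent split: if_splits)

lemma mon_in_support_ideal_iff:
  "(mon m :: 'k::field mpoly) \<in> support_ideal F \<longleftrightarrow> Poly_Mapping.keys m \<in> F"
  by (simp add: support_ideal_def)

lemma squarefree_exponent_dividesE: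
  fixes u m :: "nat \<Rightarrow>\<^sub>0 nat"
  assumes "Poly_Mapping.keys u \<subseteq> Poly_Mapping.keys m" and "\<And>i. Poly_Mapping.lookup u i \<le> 1"
  obtains v where "m = u + v"
proof
  show "m = u + (m - u)"
  proof (rule poly_mapping_eqI)
    fix i
    have "Poly_Mapping.lookup u i \<le> Poly_Mapping.lookup m i"
      using assms(2)[of i] subsetD[OF assms(1), of i]
      by (cases "Poly_Mapping.lookup u i = 0") (auto simp: in_keys_iff simp flip: Suc_le_eq)
    then show "Poly_Mapping.lookup m i = Poly_Mapping.lookup (u + (m - u)) i"
      by (simp add: lookup_add Poly_Mapping.minus_poly_mapping.rep_eq)
  qed
qed

text \<open>Whether a squarefree monomial divides another monomial is decided by the supports alone;
  this is why membership in a squarefree monomial ideal depends only on supports.\<close>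

lemma genideal_supports:
  assumes F: "up_closed V F"
    and U: "\<And>u. u \<in> U \<Longrightarrow> Poly_Mapping.keys u \<in> F"
    and squarefree: "\<And>A. A \<in> F \<Longrightarrow> finite A \<Longrightarrow>
      \<exists>u\<in>U. Poly_Mapping.keys u \<subseteq> A \<and> (\<forall>i. Poly_Mapping.lookup u i \<le> 1)"
  shows "genideal (mpoly_ring V) (mon ` U) = (support_ideal F :: 'k::field mpoly set)"
proof -
  have "Poly_Mapping.keys m \<in> F \<longleftrightarrow>
      Poly_Mapping.keys m \<subseteq> V \<and> (\<exists>u\<in>U. \<exists>v. m = u + v)" for m
  proof
    assume m: "Poly_Mapping.keys m \<in> F"
    obtain u where u: "u \<in> U" "Poly_Mapping.keys u \<subseteq> Poly_Mapping.keys m"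
      "\<And>i. Poly_Mapping.lookup u i \<le> 1"
      using squarefree[OF m finite_keys] by blast
    obtain v where "m = u + v"
      using u(2,3) by (rule squarefree_exponent_dividesE)
    then show "Poly_Mapping.keys m \<subseteq> V \<and> (\<exists>u\<in>U. \<exists>v. m = u + v)"
      using u(1) up_closed_subset[OF F m] by blast
  next
    assume m: "Poly_Mapping.keys m \<subseteq> V \<and> (\<exists>u\<in>U. \<exists>v. m = u + v)"
    then obtain u v where "u \<in> U" "m = u + v" by blast
    then show "Poly_Mapping.keys m \<in> F"
      using up_closedD[OF F U] m by (simp add: keys_add_exponent)
  qed
  then show ?thesis
    using U up_closed_subset[OF F] by (subst genideal_monomials) (auto simp: support_ideal_def)
qed

lemma genideal_squarefree_exponents:
  assumes "finite V" and F: "up_closed V F"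
  shows "genideal (mpoly_ring V) (mon ` squarefree_exponent ` F)
      = (support_ideal F :: 'k::field mpoly set)"
    and "mon ` squarefree_exponent ` F \<subseteq> (squarefree_monomials V :: 'k mpoly set)"
proof -
  have fin: "finite A" if "A \<in> F" for A
    using up_closed_subset[OF F that] assms(1) by (rule finite_subset)
  show "genideal (mpoly_ring V) (mon ` squarefree_exponent ` F) = (support_ideal F :: 'k mpoly set)"
  proof (rule genideal_supports[OF F])
    fix A assume "A \<in> F" "finite A"
    then show "\<exists>u\<in>squarefree_exponent ` F. Poly_Mapping.keys u \<subseteq> A \<and> (\<forall>i. Poly_Mapping.lookup u i \<le> 1)"
      by (intro bexI[of _ "squarefree_exponent A"])
        (simp_all add: keys_squarefree_exponent lookup_squarefree_exponent)
  qed (auto simp: keys_squarefree_exponent fin)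
  show "mon ` squarefree_exponent ` F \<subseteq> (squarefree_monomials V :: 'k mpoly set)"
    using up_closed_subset[OF F] fin
    by (fastforce simp: squarefree_monomials_def keys_squarefree_exponent
        lookup_squarefree_exponent)
qed

lemma squarefree_monomial_ideal_iff:
  assumes "finite V"
  shows "squarefree_monomial_ideal V (I :: 'k::field mpoly set) \<longleftrightarrow>
    (\<exists>F. up_closed V F \<and> I = support_ideal F)"
proof
  assume "squarefree_monomial_ideal V I"
  then obtain M where M: "M \<subseteq> squarefree_monomials V" "I = genideal (mpoly_ring V) M"
    by (auto simp: squarefree_monomial_ideal_def)
  define U where "U = {m. (mon m :: 'k mpoly) \<in> M}"
  have MU: "M = mon ` U"
    using M(1) by (auto simp: U_def squarefree_monomials_def)
  have inj: "m = m'" if "mon m = (mon m' :: 'k mpoly)" for m m'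
    using that keys_mon by (metis singleton_inject)
  have U: "Poly_Mapping.keys u \<subseteq> V" "Poly_Mapping.lookup u i \<le> 1" if "u \<in> U" for u i
    using that M(1) by (auto simp: U_def squarefree_monomials_def dest!: subsetD inj)
  define F where "F = {A. A \<subseteq> V \<and> (\<exists>u\<in>U. Poly_Mapping.keys u \<subseteq> A)}"
  have F: "up_closed V F"
    by (auto simp: up_closed_def F_def)
  have "I = support_ideal F"
    unfolding M(2) MU using U by (intro genideal_supports[OF F]) (auto simp: F_def)
  then show "\<exists>F. up_closed V F \<and> I = support_ideal F" using F by blast
next
  assume "\<exists>F. up_closed V F \<and> I = support_ideal F"
  then obtain F where F: "up_closed V F" "I = support_ideal F" by blast
  show "squarefree_monomial_ideal V I"
    unfolding squarefree_monomial_ideal_def F(2)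
    using genideal_squarefree_exponents[OF assms F(1)] by metis
qed

lemma support_ideal_is_ideal:
  assumes "finite V" "up_closed V F"
  shows "ideal (support_ideal F) (mpoly_ring V :: 'k::field mpoly ring)"
proof -
  interpret cring "mpoly_ring V :: 'k mpoly ring" by (rule cring_mpoly_ring)
  have "squarefree_monomials V \<subseteq> carrier (mpoly_ring V :: 'k mpoly ring)"
    by (auto simp: squarefree_monomials_def mon_in_carrier_iff)
  with genideal_squarefree_exponents(2)[OF assms] show ?thesis
    unfolding genideal_squarefree_exponents(1)[OF assms, symmetric]
    by (intro genideal_ideal) (rule order_trans)
qed

section \<open>The Alexander dual\<close>

text \<open>For the extreme exponents of two factors, in any monomial order, the decomposition of their sum
  is unique, so the corresponding coefficients multiply without interference.\<close>

lemma lookup_times_unique_decomposition: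
  fixes f g :: "'a::cancel_comm_monoid_add \<Rightarrow>\<^sub>0 'b::semiring_0"
  assumes "\<And>l q. l \<in> Poly_Mapping.keys f \<Longrightarrow> q \<in> Poly_Mapping.keys g \<Longrightarrow> l + q = a + b \<Longrightarrow> l = a"
  shows "Poly_Mapping.lookup (f * g) (a + b) = Poly_Mapping.lookup f a * Poly_Mapping.lookup g b"
proof -
  have "Poly_Mapping.lookup f l * (\<Sum>q. Poly_Mapping.lookup g q when a + b = l + q)
      = (Poly_Mapping.lookup f a * Poly_Mapping.lookup g b when l = a)" for l
  proof (cases "l = a")
    case False
    then have "l \<notin> Poly_Mapping.keys f \<or> (\<forall>q. (Poly_Mapping.lookup g q when a + b = l + q) = 0)"
      using assms[of l] by (metis in_keys_iff when_simps)
    then show ?thesis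
      using False by (auto simp: in_keys_iff)
  qed simp
  then show ?thesis
    by (simp add: lookup_mult)
qed

text \<open>The least and the greatest exponents of \<open>d\<close> and \<open>e\<close>, in the lexicographic order, add up to
  exponents of \<open>d * e\<close>. If that product is a monomial, both sums agree, so the least and the
  greatest exponent of \<open>d\<close> coincide.\<close>

lemma divisor_of_monomial:
  fixes d e :: "'k::field mpoly"
  assumes "d * e = mon m"
  obtains a c where "d = Poly_Mapping.single a c" "c \<noteq> 0" "Poly_Mapping.keys a \<subseteq> Poly_Mapping.keys m"
proof -
  let ?D = "Poly_Mapping.keys d" and ?E = "Poly_Mapping.keys e"
  have "mon m \<noteq> (0 :: 'k mpoly)"
    using keys_mon by (metis insert_not_empty keys_zero)
  then have "d \<noteq> 0" "e \<noteq> 0"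
    using assms by auto
  then have ne: "?D \<noteq> {}" "?E \<noteq> {}"
    by (auto simp: poly_mapping_eq_iff fun_eq_iff in_keys_iff)
  have extreme: "a + b = m" if ab: "a \<in> ?D" "b \<in> ?E"
    and uniq: "\<And>l q. l \<in> ?D \<Longrightarrow> q \<in> ?E \<Longrightarrow> l + q = a + b \<Longrightarrow> l = a" for a b
  proof -
    have "Poly_Mapping.lookup (d * e) (a + b) = Poly_Mapping.lookup d a * Poly_Mapping.lookup e b"
      using uniq by (rule lookup_times_unique_decomposition)
    then have "a + b \<in> Poly_Mapping.keys (d * e)"
      using ab by (simp add: in_keys_iff)
    then show ?thesis by (simp add: assms)
  qed
  have "Min ?D + Min ?E = m"
  proof (rule extreme)
    fix l q assume lq: "l \<in> ?D" "q \<in> ?E" "l + q = Min ?D + Min ?E"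
    then have "Min ?D \<le> l" "Min ?E \<le> q" by simp_all
    then show "l = Min ?D"
      using lq(3) add_less_le_mono[of "Min ?D" l "Min ?E" q] by (metis order_less_irrefl order_le_less)
  qed (use ne in auto)
  moreover have "Max ?D + Max ?E = m"
  proof (rule extreme)
    fix l q assume lq: "l \<in> ?D" "q \<in> ?E" "l + q = Max ?D + Max ?E"
    then have "l \<le> Max ?D" "q \<le> Max ?E" by simp_all
    then show "l = Max ?D"
      using lq(3) add_less_le_mono[of l "Max ?D" q "Max ?E"] by (metis order_less_irrefl order_le_less)
  qed (use ne in auto)
  moreover have le: "Min ?D \<le> Max ?D" "Min ?E \<le> Max ?E"
    using ne by (auto intro: Min.coboundedI)
  ultimately have "Min ?D = Max ?D"
    using add_less_le_mono[of "Min ?D" "Max ?D" "Min ?E" "Max ?E"]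
    by (metis order_less_irrefl order_le_less)
  then have D: "?D = {Min ?D}"
    using ne by (metis Max_ge Min_in Min_le finite_keys order_antisym subsetI subset_singletonD singleton_iff)
  show thesis
  proof
    show "d = Poly_Mapping.single (Min ?D) (Poly_Mapping.lookup d (Min ?D))"
      using D by (intro poly_mapping_eqI) (metis in_keys_iff lookup_single_eq lookup_single_not_eq singletonD)
    show "Poly_Mapping.lookup d (Min ?D) \<noteq> 0"
      using ne Min_in[of ?D] by (simp add: in_keys_iff)
    show "Poly_Mapping.keys (Min ?D) \<subseteq> Poly_Mapping.keys m"
      using \<open>Min ?D + Min ?E = m\<close> by (metis keys_add_exponent sup_ge1)
  qed
qed

text \<open>A common divisor is a scalar times a monomial whose support lies in both supports; it is a unit
  when these are disjoint. Conversely, a shared variable is itself a nontrivial common divisor.\<close>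

lemma nontrivial_common_divisor_mon_iff:
  assumes "Poly_Mapping.keys p \<subseteq> V" "Poly_Mapping.keys q \<subseteq> V"
  shows "nontrivial_common_divisor V (mon p) (mon q :: 'k::field mpoly) \<longleftrightarrow>
    Poly_Mapping.keys p \<inter> Poly_Mapping.keys q \<noteq> {}"
proof
  assume "nontrivial_common_divisor V (mon p) (mon q :: 'k mpoly)"
  then obtain d e e' :: "'k mpoly" where d: "d \<notin> Units (mpoly_ring V)"
    and e: "d * e = mon p" "d * e' = mon q"
    unfolding nontrivial_common_divisor_def factor_def
    by (metis mpoly_ring_mult)
  obtain a c where a: "d = Poly_Mapping.single a c" "c \<noteq> 0" "Poly_Mapping.keys a \<subseteq> Poly_Mapping.keys p"
    using e(1) by (rule divisor_of_monomial)
  obtain a' c' where "d = Poly_Mapping.single a' c'" "c' \<noteq> 0" "Poly_Mapping.keys a' \<subseteq> Poly_Mapping.keys q"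
    using e(2) by (rule divisor_of_monomial)
  then have aq: "Poly_Mapping.keys a \<subseteq> Poly_Mapping.keys q"
    using a(1,2) by (metis keys_single singleton_inject)
  show "Poly_Mapping.keys p \<inter> Poly_Mapping.keys q \<noteq> {}"
  proof
    assume "Poly_Mapping.keys p \<inter> Poly_Mapping.keys q = {}"
    then have "a = 0"
      using a(3) aq by (intro poly_mapping_eqI) (auto simp: in_keys_iff disjoint_iff subset_iff)
    then have "d * Poly_Mapping.single 0 (1 / c) = 1" "Poly_Mapping.single 0 (1 / c) * d = 1"
      using a by (simp_all add: mult_single)
    moreover have "d \<in> carrier (mpoly_ring V)" "Poly_Mapping.single 0 (1 / c) \<in> carrier (mpoly_ring V)"
      using \<open>a = 0\<close> a(1) by (simp_all add: mpoly_ring_def)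
    ultimately have "d \<in> Units (mpoly_ring V)"
      unfolding Units_def mpoly_ring_mult by (auto simp only: mpoly_ring_def monoid.select_convs)
    then show False using d by blast
  qed
next
  assume "Poly_Mapping.keys p \<inter> Poly_Mapping.keys q \<noteq> {}"
  then obtain i where i: "i \<in> Poly_Mapping.keys p" "i \<in> Poly_Mapping.keys q" by blast
  have dvd: "(Var i :: 'k mpoly) divides\<^bsub>mpoly_ring V\<^esub> mon r"
    if r: "i \<in> Poly_Mapping.keys r" "Poly_Mapping.keys r \<subseteq> V" for r
  proof -
    have eq: "r = Poly_Mapping.single i 1 + (r - Poly_Mapping.single i 1)"
      using r(1) by (intro poly_mapping_eqI)
        (auto simp: lookup_add lookup_single when_def Poly_Mapping.minus_poly_mapping.rep_eq
          in_keys_iff)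
    then have "mon r = (Var i :: 'k mpoly) * mon (r - Poly_Mapping.single i 1)"
      by (simp add: Var_def mon_def mult_single)
    moreover have "(mon (r - Poly_Mapping.single i 1) :: 'k mpoly) \<in> carrier (mpoly_ring V)"
      using r(2) eq by (metis keys_add_exponent le_sup_iff mon_in_carrier_iff)
    ultimately show ?thesis
      unfolding factor_def mpoly_ring_mult by blast
  qed
  have "Var i \<notin> Units (mpoly_ring V :: 'k mpoly ring)"
  proof
    assume "Var i \<in> Units (mpoly_ring V :: 'k mpoly ring)"
    then obtain e :: "'k mpoly" where "Var i * e = mon 0"
      unfolding Units_def mpoly_ring_mult by (auto simp: mpoly_ring_def mon_def)
    then obtain a and c :: 'k where "Var i = Poly_Mapping.single a c" "c \<noteq> 0" "Poly_Mapping.keys a \<subseteq> {}"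
      by (metis divisor_of_monomial keys_zero)
    then have "Poly_Mapping.single i (1::nat) = 0"
      by (metis keys_single Var_def zero_neq_one singleton_inject keys_eq_empty subset_empty)
    then show False
      by (metis lookup_single_eq lookup_zero zero_neq_one)
  qed
  then show "nontrivial_common_divisor V (mon p) (mon q :: 'k mpoly)"
    unfolding nontrivial_common_divisor_def
    using i assms dvd by (intro bexI[of _ "Var i"]) (auto intro: Var_in_carrier)
qed

text \<open>A set meets all members of an upward closed family iff its complement is not a member, because
  the complement is the largest set that it does not meet. Finiteness of \<open>V\<close> makes this complement
  the support of a monomial.\<close>

lemma alexander_dual_support_ideal:
  assumes V: "finite V" and F: "up_closed V F"
  shows "alexander_dual V (support_ideal F) = (support_ideal (dual_family V F) :: 'k::field mpoly set)"
proof -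
  have D: "up_closed V (dual_family V F)"
    using F by (rule up_closed_dual_family)
  have "(\<forall>q \<in> monomials V \<inter> support_ideal F. nontrivial_common_divisor V (mon m :: 'k mpoly) q)
      \<longleftrightarrow> V - Poly_Mapping.keys m \<notin> F" if m: "Poly_Mapping.keys m \<subseteq> V" for m
  proof -
    have "(\<forall>q \<in> monomials V \<inter> support_ideal F. nontrivial_common_divisor V (mon m :: 'k mpoly) q)
      \<longleftrightarrow> (\<forall>k :: nat \<Rightarrow>\<^sub>0 nat. Poly_Mapping.keys k \<in> F \<longrightarrow> Poly_Mapping.keys m \<inter> Poly_Mapping.keys k \<noteq> {})"
      (is "?L \<longleftrightarrow> ?R")
    proof
      assume L: ?L
      show ?R
      proof (intro allI impI)
        fix k :: "nat \<Rightarrow>\<^sub>0 nat" assume k: "Poly_Mapping.keys k \<in> F"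
        then have kV: "Poly_Mapping.keys k \<subseteq> V" by (rule up_closed_subset[OF F])
        then have "(mon k :: 'k mpoly) \<in> monomials V \<inter> support_ideal F"
          using k by (auto simp: monomials_def mon_in_support_ideal_iff)
        then show "Poly_Mapping.keys m \<inter> Poly_Mapping.keys k \<noteq> {}"
          using L nontrivial_common_divisor_mon_iff[OF m kV] by blast
      qed
    next
      assume ?R
      then show ?L
        using m by (auto simp: monomials_def mon_in_support_ideal_iff nontrivial_common_divisor_mon_iff
            simp del: disjoint_iff)
    qed
    also have "\<dots> \<longleftrightarrow> V - Poly_Mapping.keys m \<notin> F"
    proof
      assume L: "\<forall>k :: nat \<Rightarrow>\<^sub>0 nat. Poly_Mapping.keys k \<in> F \<longrightarrow> Poly_Mapping.keys m \<inter> Poly_Mapping.keys k \<noteq> {}"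
      show "V - Poly_Mapping.keys m \<notin> F"
        using L[rule_format, of "squarefree_exponent (V - Poly_Mapping.keys m)"] V
        by (auto simp: keys_squarefree_exponent)
    next
      assume R: "V - Poly_Mapping.keys m \<notin> F"
      show "\<forall>k :: nat \<Rightarrow>\<^sub>0 nat. Poly_Mapping.keys k \<in> F \<longrightarrow> Poly_Mapping.keys m \<inter> Poly_Mapping.keys k \<noteq> {}"
      proof (intro allI impI notI)
        fix k :: "nat \<Rightarrow>\<^sub>0 nat" assume k: "Poly_Mapping.keys k \<in> F" "Poly_Mapping.keys m \<inter> Poly_Mapping.keys k = {}"
        then have "Poly_Mapping.keys k \<subseteq> V - Poly_Mapping.keys m"
          using up_closed_subset[OF F k(1)] by blast
        then show False using R up_closedD[OF F k(1)] by blast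
      qed
    qed
    finally show ?thesis .
  qed
  then have "{p \<in> monomials V. \<forall>q \<in> monomials V \<inter> support_ideal F. nontrivial_common_divisor V p q}
      = (mon ` {m. Poly_Mapping.keys m \<in> dual_family V F} :: 'k mpoly set)"
    by (auto simp: monomials_def dual_family_def)
  then show ?thesis
    unfolding alexander_dual_def
  proof (simp only:, intro genideal_supports[OF D])
    fix A assume "A \<in> dual_family V F" "finite A"
    then show "\<exists>u\<in>{m :: nat \<Rightarrow>\<^sub>0 nat. Poly_Mapping.keys m \<in> dual_family V F}.
        Poly_Mapping.keys u \<subseteq> A \<and> (\<forall>i. Poly_Mapping.lookup u i \<le> 1)"
      by (intro bexI[of _ "squarefree_exponent A"])
        (simp_all add: keys_squarefree_exponent lookup_squarefree_exponent)
  qed simp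
qed

section \<open>Regularity of a difference of two variables\<close>

lemma regular_element_Quot_iff:
  fixes R (structure)
  assumes "ideal I R" and a: "a \<in> carrier R"
  shows "regular_element (R Quot I) (I +> a) \<longleftrightarrow> (\<forall>f\<in>carrier R. a \<otimes> f \<in> I \<longrightarrow> f \<in> I)"
proof -
  interpret ideal I R by fact
  have coset: "I +> x = I \<longleftrightarrow> x \<in> I" if "x \<in> carrier R" for x
    using that a_rcos_const rcos_const_imp_mem by blast
  have carrier: "carrier (R Quot I) = (\<lambda>x. I +> x) ` carrier R"
    by (auto simp: FactRing_def A_RCOSETS_def')
  have mult: "(I +> a) \<otimes>\<^bsub>R Quot I\<^esub> (I +> x) = I +> (a \<otimes> x)" if "x \<in> carrier R" for x
    using rcoset_mult_add[OF a that] by (simp add: FactRing_def)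
  have zero: "\<zero>\<^bsub>R Quot I\<^esub> = I"
    by (simp add: FactRing_def)
  have "regular_element (R Quot I) (I +> a) \<longleftrightarrow>
      (\<forall>x\<in>carrier R. (I +> a) \<otimes>\<^bsub>R Quot I\<^esub> (I +> x) = I \<longrightarrow> I +> x = I)"
    using a unfolding regular_element_def carrier zero by blast
  also have "\<dots> \<longleftrightarrow> (\<forall>f\<in>carrier R. a \<otimes> f \<in> I \<longrightarrow> f \<in> I)"
    using a by (intro ball_cong refl) (simp add: mult coset)
  finally show ?thesis .
qed

lemma lookup_Var_times_eq_0:
  fixes f :: "'k::field mpoly"
  assumes "\<And>k. k \<in> Poly_Mapping.keys f \<Longrightarrow> m \<noteq> Poly_Mapping.single i 1 + k"
  shows "Poly_Mapping.lookup (Var i * f) m = 0"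
proof (rule ccontr)
  assume "Poly_Mapping.lookup (Var i * f) m \<noteq> 0"
  then have "m \<in> Poly_Mapping.keys (Var i * f)" by (simp add: in_keys_iff)
  then show False
    using assms unfolding Var_eq_mon keys_mon_times by blast
qed

text \<open>If \<open>C\<close> violated the condition, the squarefree monomial with support \<open>C\<close> would be a nonzero
  element of the quotient killed by the difference of the two variables.\<close>

lemma regular_imp_facets_meet:
  assumes fin: "finite V" and F: "up_closed V F"
    and reg: "\<And>f :: 'k::field mpoly. f \<in> carrier (mpoly_ring V) \<Longrightarrow>
      (Var b - Var a) * f \<in> support_ideal F \<Longrightarrow> f \<in> support_ideal F"
  shows "facets_meet a b F"
  unfolding facets_meet_def
proof (intro allI impI)
  fix C assume C: "insert a C \<in> F" "insert b C \<in> F"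
  then have CV: "C \<subseteq> V" using up_closed_subset[OF F] by blast
  then have k: "Poly_Mapping.keys (squarefree_exponent C) = C"
    using fin by (simp add: keys_squarefree_exponent finite_subset)
  have "(Var b - Var a) * mon (squarefree_exponent C)
      = mon (Poly_Mapping.single b 1 + squarefree_exponent C)
        - (mon (Poly_Mapping.single a 1 + squarefree_exponent C) :: 'k mpoly)"
    by (simp add: left_diff_distrib Var_def mon_def mult_single)
  also have "\<dots> \<in> support_ideal F"
    using C keys_diff[of "mon (Poly_Mapping.single b 1 + squarefree_exponent C) :: 'k mpoly"
        "mon (Poly_Mapping.single a 1 + squarefree_exponent C)"]
    by (auto simp: support_ideal_def keys_add_exponent k)
  finally have "mon (squarefree_exponent C) \<in> (support_ideal F :: 'k mpoly set)"
    using CV by (intro reg[of "mon (squarefree_exponent C)"]) (simp_all add: mon_in_carrier_iff k)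
  then show "C \<in> F" by (simp add: mon_in_support_ideal_iff k)
qed

text \<open>Consider a term of \<open>f\<close> outside the ideal whose degree in \<open>Var b\<close> is maximal among such terms.
  Its product with \<open>Var b\<close> either survives in \<open>(Var b - Var a) * f\<close>, and then belongs to the ideal,
  or is cancelled by \<open>Var a\<close> times a term of higher degree in \<open>Var b\<close>; that term divides a monomial
  outside the ideal, so it is itself outside, contradicting maximality.\<close>

lemma max_degree_nonmember_term_times_Var:
  fixes f :: "'k::field mpoly"
  assumes F: "up_closed V F" and ab: "a \<noteq> b" "b \<in> V"
    and f: "f \<in> carrier (mpoly_ring V)"
    and prod: "(Var b - Var a) * f \<in> support_ideal F"
    and m: "m \<in> Poly_Mapping.keys f" "Poly_Mapping.keys m \<notin> F"
    and max: "\<And>k. k \<in> Poly_Mapping.keys f \<Longrightarrow> Poly_Mapping.keys k \<notin> F \<Longrightarrow>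
      Poly_Mapping.lookup k b \<le> Poly_Mapping.lookup m b"
  shows "insert b (Poly_Mapping.keys m) \<in> F"
proof (rule ccontr)
  let ?xm = "Poly_Mapping.single b 1 + m"
  assume nF: "insert b (Poly_Mapping.keys m) \<notin> F"
  have keys: "Poly_Mapping.keys ?xm = insert b (Poly_Mapping.keys m)"
    by (simp add: keys_add_exponent)
  have "?xm \<notin> Poly_Mapping.keys ((Var b - Var a) * f)"
    using prod nF keys by (auto simp: support_ideal_def)
  then have "Poly_Mapping.lookup (Var a * f) ?xm = Poly_Mapping.lookup (Var b * f) ?xm"
    by (simp add: in_keys_iff left_diff_distrib lookup_minus)
  also have "\<dots> = Poly_Mapping.lookup f m"
    unfolding Var_eq_mon by (rule lookup_mon_times)
  also have "\<dots> \<noteq> 0" using m by (simp add: in_keys_iff)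
  finally obtain k where k: "k \<in> Poly_Mapping.keys f" "?xm = Poly_Mapping.single a 1 + k"
    using lookup_Var_times_eq_0 by blast
  have "Poly_Mapping.keys k \<subseteq> insert b (Poly_Mapping.keys m)"
    using keys unfolding k(2) keys_add_exponent by blast
  moreover have "insert b (Poly_Mapping.keys m) \<subseteq> V"
    using f m ab by (auto simp: mpoly_ring_def)
  ultimately have "Poly_Mapping.keys k \<notin> F"
    using nF up_closedD[OF F] by blast
  moreover have "Poly_Mapping.lookup k b = Suc (Poly_Mapping.lookup m b)"
    using arg_cong[OF k(2), of "\<lambda>x. Poly_Mapping.lookup x b"] ab
    by (simp add: lookup_add lookup_single when_def)
  ultimately show False using max[OF k(1)] by simp
qed

text \<open>The product of a maximal term \<open>t\<close> with \<open>Var b\<close> lies in the ideal while \<open>t\<close> does not, so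
  \<open>Var b\<close> cannot occur in \<open>t\<close>. The maximal degree is therefore \<open>0\<close>, which makes every term
  outside the ideal a maximal one.\<close>

lemma nonmember_term_times_Var:
  fixes f :: "'k::field mpoly"
  assumes F: "up_closed V F" and ab: "a \<noteq> b" "b \<in> V"
    and f: "f \<in> carrier (mpoly_ring V)"
    and prod: "(Var b - Var a) * f \<in> support_ideal F"
    and m: "m \<in> Poly_Mapping.keys f" "Poly_Mapping.keys m \<notin> F"
  shows "insert b (Poly_Mapping.keys m) \<in> F"
proof -
  define B where "B = {k \<in> Poly_Mapping.keys f. Poly_Mapping.keys k \<notin> F}"
  have B: "finite ((\<lambda>k. Poly_Mapping.lookup k b) ` B)" "B \<noteq> {}"
    using m by (auto simp: B_def)
  then have "Max ((\<lambda>k. Poly_Mapping.lookup k b) ` B) \<in> (\<lambda>k. Poly_Mapping.lookup k b) ` B"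
    by (intro Max_in) auto
  then obtain t where t: "t \<in> B"
    "Poly_Mapping.lookup t b = Max ((\<lambda>k. Poly_Mapping.lookup k b) ` B)" by auto
  have le: "Poly_Mapping.lookup k b \<le> Poly_Mapping.lookup t b" if "k \<in> B" for k
    using t(2) B(1) that by (metis Max_ge imageI)
  have "insert b (Poly_Mapping.keys t) \<in> F"
    using t(1) le by (intro max_degree_nonmember_term_times_Var[OF F ab f prod]) (auto simp: B_def)
  then have "Poly_Mapping.lookup t b = 0"
    using t(1) by (metis (mono_tags, lifting) B_def in_keys_iff insert_absorb mem_Collect_eq)
  then have "Poly_Mapping.lookup k b = 0" if "k \<in> B" for k
    using le[OF that] by simp
  then show ?thesis
    using m by (intro max_degree_nonmember_term_times_Var[OF F ab f prod m]) (auto simp: B_def)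
qed

text \<open>A term of \<open>f\<close> outside the ideal would be moved into it by each of the two variables, by the
  preceding lemma and its mirror image; its support then violates the condition on \<open>F\<close>.\<close>

lemma facets_meet_imp_regular:
  fixes f :: "'k::field mpoly"
  assumes F: "up_closed V F" and ab: "a \<noteq> b" "a \<in> V" "b \<in> V"
    and meet: "facets_meet a b F"
    and f: "f \<in> carrier (mpoly_ring V)"
    and prod: "(Var b - Var a) * f \<in> support_ideal F"
  shows "f \<in> support_ideal F"
proof -
  have "(Var a - Var b) * f = - ((Var b - Var a) * f)"
    by (simp add: algebra_simps)
  then have prod': "(Var a - Var b) * f \<in> support_ideal F"
    using prod by (simp add: support_ideal_def in_keys_iff)
  have "Poly_Mapping.keys m \<in> F" if m: "m \<in> Poly_Mapping.keys f" for m
  proof (rule ccontr)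
    assume nF: "Poly_Mapping.keys m \<notin> F"
    have "insert b (Poly_Mapping.keys m) \<in> F" "insert a (Poly_Mapping.keys m) \<in> F"
      by (rule nonmember_term_times_Var[OF F ab(1,3) f prod m nF]
          nonmember_term_times_Var[OF F ab(1)[symmetric] ab(2) f prod' m nF])+
    then show False
      using meet nF by (simp add: facets_meet_def)
  qed
  then show ?thesis by (simp add: support_ideal_def)
qed

lemma regular_difference_iff_facets_meet:
  assumes fin: "finite V" and F: "up_closed V F" and ab: "a \<noteq> b" "a \<in> V" "b \<in> V"
  shows "regular_element ((mpoly_ring V :: 'k::field mpoly ring) Quot support_ideal F)
      (support_ideal F +>\<^bsub>mpoly_ring V\<^esub> (Var b - Var a)) \<longleftrightarrow> facets_meet a b F"
    (is "?reg \<longleftrightarrow> _")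
proof -
  have "(Var b - Var a :: 'k mpoly) \<in> carrier (mpoly_ring V)"
    using ab by (intro mpoly_ring_minus_closed Var_in_carrier)
  then have "?reg \<longleftrightarrow> (\<forall>f :: 'k mpoly \<in> carrier (mpoly_ring V).
      (Var b - Var a) * f \<in> support_ideal F \<longrightarrow> f \<in> support_ideal F)"
    unfolding mpoly_ring_mult[symmetric, where V = V]
    by (rule regular_element_Quot_iff[OF support_ideal_is_ideal[OF fin F]])
  also have "\<dots> \<longleftrightarrow> facets_meet a b F"
  proof
    assume L: "\<forall>f :: 'k mpoly \<in> carrier (mpoly_ring V).
      (Var b - Var a) * f \<in> support_ideal F \<longrightarrow> f \<in> support_ideal F"
    show "facets_meet a b F"
      by (rule regular_imp_facets_meet[OF fin F]) (use L in blast)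
  qed (intro ballI impI, rule facets_meet_imp_regular[OF F ab])
  finally show ?thesis .
qed

section \<open>Identifying two variables\<close>

definition collapse :: "nat \<Rightarrow> nat"
  where "collapse i = (if i \<le> 1 then 1 else i)"

text \<open>The exponent of the image of a monomial under \<open>identify01\<close>.\<close>
definition merge :: "(nat \<Rightarrow>\<^sub>0 nat) \<Rightarrow> (nat \<Rightarrow>\<^sub>0 nat)"
  where "merge m = (\<Sum>i\<in>Poly_Mapping.keys m. Poly_Mapping.single (collapse i) (Poly_Mapping.lookup m i))"

lemma lookup_merge:
  "Poly_Mapping.lookup (merge m) j =
    (if j = 0 then 0 else if j = 1 then Poly_Mapping.lookup m 0 + Poly_Mapping.lookup m 1
     else Poly_Mapping.lookup m j)"
proof -
  let ?g = "\<lambda>i. if collapse i = j then Poly_Mapping.lookup m i else 0"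
  have "Poly_Mapping.lookup (merge m) j = sum ?g (Poly_Mapping.keys m)"
    by (simp add: merge_def lookup_sum lookup_single when_def)
  also have "\<dots> = sum ?g (Poly_Mapping.keys m \<union> {0, 1, j})"
    by (rule sum.mono_neutral_left) (auto simp: in_keys_iff)
  also have "\<dots> = sum ?g {0, 1, j}"
    by (rule sum.mono_neutral_right) (auto simp: collapse_def)
  finally show ?thesis
    by (simp add: collapse_def)
qed

lemma keys_merge: "Poly_Mapping.keys (merge m) = collapse ` Poly_Mapping.keys m"
proof
  show "Poly_Mapping.keys (merge m) \<subseteq> collapse ` Poly_Mapping.keys m"
  proof
    fix j assume "j \<in> Poly_Mapping.keys (merge m)"
    then have "j = 1 \<and> (0 \<in> Poly_Mapping.keys m \<or> 1 \<in> Poly_Mapping.keys m)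
        \<or> j > 1 \<and> j \<in> Poly_Mapping.keys m"
      by (auto simp: in_keys_iff lookup_merge split: if_splits)
    moreover have "collapse 0 = 1" "collapse 1 = 1" "j > 1 \<Longrightarrow> collapse j = j"
      by (auto simp: collapse_def)
    ultimately show "j \<in> collapse ` Poly_Mapping.keys m"
      by (metis imageI)
  qed
  show "collapse ` Poly_Mapping.keys m \<subseteq> Poly_Mapping.keys (merge m)"
    by (auto simp: in_keys_iff lookup_merge collapse_def le_Suc_eq)
qed

lemma Var_power: "(Var i :: 'k::field mpoly) ^ e = mon (Poly_Mapping.single i e)"
  by (induction e) (simp_all add: Var_def mon_def mult_single flip: single_add)

lemma prod_mon:
  "finite A \<Longrightarrow> (\<Prod>i\<in>A. mon (u i) :: 'k::field mpoly) = mon (\<Sum>i\<in>A. u i)"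
  by (induction A rule: finite_induct) (simp_all add: mon_def mult_single)

lemma identify01_eq_sum:
  "identify01 p = (\<Sum>m\<in>Poly_Mapping.keys p. Poly_Mapping.single (merge m) (Poly_Mapping.lookup p m))"
proof -
  have "Const c * (\<Prod>i\<in>Poly_Mapping.keys m. (if i \<le> 1 then Var 1 else Var i) ^ Poly_Mapping.lookup m i)
      = Poly_Mapping.single (merge m) c" for m and c :: 'a
  proof -
    have "(if i \<le> 1 then Var 1 else Var i :: 'a mpoly) = Var (collapse i)" for i
      by (simp add: collapse_def)
    then show ?thesis
      by (simp add: Var_power prod_mon merge_def[symmetric]) (simp add: Const_def mon_def mult_single)
  qed
  then show ?thesis
    by (simp add: identify01_def mpoly_subst_def)
qed

lemma identify01_single: "identify01 (Poly_Mapping.single m c) = Poly_Mapping.single (merge m) c"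
  by (simp add: identify01_eq_sum)

lemma identify01_add: "identify01 (p + q) = identify01 p + identify01 q"
proof -
  let ?A = "Poly_Mapping.keys p \<union> Poly_Mapping.keys q"
  have ext: "identify01 r = (\<Sum>m\<in>?A. Poly_Mapping.single (merge m) (Poly_Mapping.lookup r m))"
    if "Poly_Mapping.keys r \<subseteq> ?A" for r
    unfolding identify01_eq_sum using that
    by (intro sum.mono_neutral_left) (auto simp: in_keys_iff)
  show ?thesis
    using Poly_Mapping.keys_add[of p q]
    by (simp add: ext lookup_add single_add sum.distrib)
qed

text \<open>The map sends terms to terms, and it keeps the coefficient, so each term over \<open>merge ` U\<close> lifts
  to a term over \<open>U\<close>. Cancellation between terms with the same image only makes the image of a given
  polynomial smaller.\<close>

lemma image_identify01:
  "identify01 ` {p :: 'k::field mpoly. Poly_Mapping.keys p \<subseteq> U} = {q. Poly_Mapping.keys q \<subseteq> merge ` U}"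
proof
  show "identify01 ` {p :: 'k mpoly. Poly_Mapping.keys p \<subseteq> U} \<subseteq> {q. Poly_Mapping.keys q \<subseteq> merge ` U}"
  proof safe
    fix p :: "'k mpoly" and k assume p: "Poly_Mapping.keys p \<subseteq> U" and "k \<in> Poly_Mapping.keys (identify01 p)"
    then have "(\<Sum>m\<in>Poly_Mapping.keys p. Poly_Mapping.lookup p m when merge m = k) \<noteq> 0"
      by (simp add: identify01_eq_sum in_keys_iff lookup_sum lookup_single)
    then obtain m where "m \<in> Poly_Mapping.keys p" "(Poly_Mapping.lookup p m when merge m = k) \<noteq> 0"
      by (rule sum.not_neutral_contains_not_neutral)
    then show "k \<in> merge ` U" using p by auto
  qed
  show "{q. Poly_Mapping.keys q \<subseteq> merge ` U} \<subseteq> identify01 ` {p :: 'k mpoly. Poly_Mapping.keys p \<subseteq> U}"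
  proof safe
    fix q :: "'k mpoly" assume q: "Poly_Mapping.keys q \<subseteq> merge ` U"
    show "q \<in> identify01 ` {p. Poly_Mapping.keys p \<subseteq> U}"
    proof (rule poly_mapping_span_induct)
      fix m and c :: 'k assume "m \<in> Poly_Mapping.keys q"
      then obtain u where "u \<in> U" "m = merge u" using q by blast
      then show "Poly_Mapping.single m c \<in> identify01 ` {p. Poly_Mapping.keys p \<subseteq> U}"
        by (intro image_eqI[of _ _ "Poly_Mapping.single u c"]) (auto simp: identify01_single)
    next
      show "0 \<in> identify01 ` {p. Poly_Mapping.keys p \<subseteq> U}"
        by (intro image_eqI[of _ _ 0]) (auto simp: identify01_eq_sum)
    next
      fix x y :: "'k mpoly"
      assume "x \<in> identify01 ` {p. Poly_Mapping.keys p \<subseteq> U}"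
        "y \<in> identify01 ` {p. Poly_Mapping.keys p \<subseteq> U}"
      then obtain p p' where "x = identify01 p" "y = identify01 p'"
        "Poly_Mapping.keys p \<subseteq> U" "Poly_Mapping.keys p' \<subseteq> U" by blast
      then show "x + y \<in> identify01 ` {p. Poly_Mapping.keys p \<subseteq> U}"
        using Poly_Mapping.keys_add[of p p']
        by (intro image_eqI[of _ _ "p + p'"]) (auto simp: identify01_add)
    qed
  qed
qed

definition collapse_family :: "nat set set \<Rightarrow> nat set set"
  where "collapse_family F = (`) collapse ` F"

lemma collapse_image: "collapse ` A = (A - {0, 1}) \<union> (if A \<inter> {0, 1} = {} then {} else {1})"
proof -
  have "collapse ` (A - {0, 1}) = A - {0, 1}"
    by (auto simp: collapse_def image_iff)
  moreover have "collapse ` (A \<inter> {0, 1}) = (if A \<inter> {0, 1} = {} then {} else {1})"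
    by (auto simp: collapse_def)
  moreover have "collapse ` A = collapse ` (A - {0, 1}) \<union> collapse ` (A \<inter> {0, 1})"
    unfolding image_Un[symmetric] by (simp only: Un_Diff_Int)
  ultimately show ?thesis by (simp only:)
qed

lemma up_closed_collapse_family:
  assumes n: "n \<ge> 1" and F: "up_closed {0..n} F"
  shows "up_closed {1..n} (collapse_family F)"
  unfolding up_closed_def
proof (intro conjI ballI allI impI)
  show "collapse_family F \<subseteq> Pow {1..n}"
  proof
    fix B assume "B \<in> collapse_family F"
    then obtain A where "A \<in> F" "B = collapse ` A" by (auto simp: collapse_family_def)
    then show "B \<in> Pow {1..n}"
      using up_closed_subset[OF F, of A] n by (auto simp: collapse_def)
  qed
next
  fix A B assume "A \<in> collapse_family F" and B: "A \<subseteq> B" "B \<subseteq> {1..n}"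
  then obtain A' where A: "A' \<in> F" "A = collapse ` A'" by (auto simp: collapse_family_def)
  have "collapse ` B = B" using B(2) by (force simp: collapse_def image_iff)
  then have "collapse ` (A' \<union> B) = B" using A B by (auto simp: image_Un)
  moreover have "A' \<union> B \<in> F"
    using up_closed_subset[OF F A(1)] B(2) by (intro up_closedD[OF F A(1)]) auto
  ultimately show "B \<in> collapse_family F" unfolding collapse_family_def by (metis imageI)
qed

text \<open>A member of the image comes from a member of \<open>F\<close> that contains at most one of \<open>0\<close> and \<open>1\<close>, as
  one of the two can be dropped if both occur. This leaves \<open>B\<close> itself, or \<open>B\<close> with \<open>1\<close> replaced by \<open>0\<close>.\<close>

lemma mem_collapse_family_iff:
  assumes "generators_omit 0 1 F" "0 \<notin> B"
  shows "B \<in> collapse_family F \<longleftrightarrow> B \<in> F \<or> 1 \<in> B \<and> insert 0 (B - {1}) \<in> F"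
proof
  assume "B \<in> collapse_family F"
  then obtain A where A: "A \<in> F" "B = collapse ` A" by (auto simp: collapse_family_def)
  show "B \<in> F \<or> 1 \<in> B \<and> insert 0 (B - {1}) \<in> F"
  proof (cases "0 \<in> A")
    case False
    then have "B = A" unfolding A(2) collapse_image by auto
    then show ?thesis using A by simp
  next
    case True
    then have B: "B = insert 1 (A - {0})" unfolding A(2) collapse_image by auto
    have e: "insert 0 (B - {1}) = A - {1}" "1 \<in> B" using True B by auto
    consider "A - {1} \<in> F" | "A - {0} \<in> F" "1 \<in> A"
      using assms(1) A(1) by (metis generators_omit_def Diff_empty Diff_insert0)
    then show ?thesis
    proof cases
      case 1
      then show ?thesis unfolding e(1) using e(2) by blast
    next
      case 2
      then have "B = A - {0}" using B by auto
      then show ?thesis using 2 by simp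
    qed
  qed
next
  assume R: "B \<in> F \<or> 1 \<in> B \<and> insert 0 (B - {1}) \<in> F"
  have "collapse i = i" if "i \<in> B" for i
    using that assms(2) by (cases "i = 0") (auto simp: collapse_def)
  then have 1: "collapse ` B = B" by simp
  have 2: "collapse ` insert 0 (B - {1}) = B" if "1 \<in> B"
  proof -
    have "insert 0 (B - {1}) - {0, 1} = B - {1}" "insert 0 (B - {1}) \<inter> {0, 1} \<noteq> {}"
      using assms(2) by auto
    then show ?thesis
      unfolding collapse_image using that by auto
  qed
  from R show "B \<in> collapse_family F"
  proof
    assume "B \<in> F"
    then show ?thesis unfolding collapse_family_def by (metis 1 imageI)
  next
    assume "1 \<in> B \<and> insert 0 (B - {1}) \<in> F"
    then show ?thesis unfolding collapse_family_def by (metis 2 imageI)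
  qed
qed

lemma image_identify01_support_ideal:
  "identify01 ` support_ideal F
    = {q :: 'k::field mpoly. Poly_Mapping.keys q \<subseteq> merge ` {m. Poly_Mapping.keys m \<in> F}}"
proof -
  have "support_ideal F = {p :: 'k mpoly. Poly_Mapping.keys p \<subseteq> {m. Poly_Mapping.keys m \<in> F}}"
    by (auto simp: support_ideal_def)
  then show ?thesis by (simp only: image_identify01)
qed

text \<open>The support of the image of a monomial is the image of its support. The content is the
  converse: a monomial whose support is the image of a member of \<open>F\<close> has to be the image of a monomial
  with support in \<open>F\<close>. If the merged variable occurs in it with exponent one, this fails for members containing both
  \<open>0\<close> and \<open>1\<close>; by hypothesis a member with at most one of them is available, and the monomial lifts
  with the whole exponent placed on that variable.\<close>

lemma image_support_ideal_eq_collapse: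
  assumes omit: "generators_omit 0 1 F"
  shows "identify01 ` support_ideal F = (support_ideal (collapse_family F) :: 'k::field mpoly set)"
proof -
  have "k \<in> merge ` {m. Poly_Mapping.keys m \<in> F}" if k: "Poly_Mapping.keys k \<in> collapse_family F" for k
  proof -
    have 0: "0 \<notin> Poly_Mapping.keys k"
      using k by (auto simp: collapse_family_def collapse_def split: if_splits)
    consider "Poly_Mapping.keys k \<in> F"
      | "1 \<in> Poly_Mapping.keys k" "insert 0 (Poly_Mapping.keys k - {1}) \<in> F"
      using mem_collapse_family_iff[OF omit 0] k by blast
    then show ?thesis
    proof cases
      case 1
      have "merge k = k"
        using 0 by (intro poly_mapping_eqI) (auto simp: lookup_merge in_keys_iff)
      then show ?thesis using 1 by (metis imageI mem_Collect_eq)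
    next
      case 2
      \<comment> \<open>Move the exponent of the variable \<open>1\<close> to the variable \<open>0\<close>.\<close>
      define m where "m = Poly_Mapping.update 0 (Poly_Mapping.lookup k 1) (Poly_Mapping.update 1 0 k)"
      have m: "Poly_Mapping.lookup m i = (if i = 0 then Poly_Mapping.lookup k 1
          else if i = 1 then 0 else Poly_Mapping.lookup k i)" for i
        by (simp add: m_def lookup_update)
      have "Poly_Mapping.keys m = insert 0 (Poly_Mapping.keys k - {1})"
        using 2(1) by (auto simp: in_keys_iff m split: if_splits)
      moreover have "merge m = k"
        using 0 by (intro poly_mapping_eqI) (auto simp: lookup_merge in_keys_iff m)
      ultimately show ?thesis using 2 by (metis imageI mem_Collect_eq)
    qed
  qed
  moreover have "Poly_Mapping.keys (merge m) \<in> collapse_family F" if "Poly_Mapping.keys m \<in> F" for m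
    using that by (simp add: keys_merge collapse_family_def)
  ultimately have "k \<in> merge ` {m. Poly_Mapping.keys m \<in> F} \<longleftrightarrow> Poly_Mapping.keys k \<in> collapse_family F" for k
    by blast
  then show ?thesis
    unfolding image_identify01_support_ideal unfolding support_ideal_def subset_eq by simp
qed

text \<open>If the image is squarefree and \<open>A \<in> F\<close> contains \<open>0\<close> and \<open>1\<close>, then the image of the squarefree
  monomial on \<open>A\<close>, whose degree in the merged variable is two, can be replaced by its squarefree part.
  A preimage of that part has total degree one in the two variables, so it omits one of them.\<close>

lemma squarefree_image_iff_generators_omit:
  assumes n: "n \<ge> 1" and F: "up_closed {0..n} F"
  shows "squarefree_monomial_ideal {1..n} (identify01 ` support_ideal F :: 'k::field mpoly set)
    \<longleftrightarrow> generators_omit 0 1 F"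
proof
  assume "generators_omit 0 1 F"
  then show "squarefree_monomial_ideal {1..n} (identify01 ` support_ideal F :: 'k mpoly set)"
    using image_support_ideal_eq_collapse up_closed_collapse_family[OF n F]
    by (subst squarefree_monomial_ideal_iff) auto
next
  assume "squarefree_monomial_ideal {1..n} (identify01 ` support_ideal F :: 'k mpoly set)"
  then obtain G where G: "identify01 ` support_ideal F = (support_ideal G :: 'k mpoly set)"
    using squarefree_monomial_ideal_iff by blast
  have GF: "Poly_Mapping.keys k \<in> G \<longleftrightarrow> k \<in> merge ` {m. Poly_Mapping.keys m \<in> F}" for k
  proof -
    have "Poly_Mapping.keys k \<in> G \<longleftrightarrow> (mon k :: 'k mpoly) \<in> identify01 ` support_ideal F"
      by (simp add: G mon_in_support_ideal_iff)
    then show ?thesis by (simp add: image_identify01_support_ideal)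
  qed
  show "generators_omit 0 1 F"
    unfolding generators_omit_def
  proof
    fix A assume A: "A \<in> F"
    then have finA: "finite A" using up_closed_subset[OF F] by (metis finite_atLeastAtMost finite_subset)
    show "A - {0} \<in> F \<or> A - {1} \<in> F"
    proof (cases "0 \<in> A \<and> 1 \<in> A")
      case False
      then show ?thesis using A by (metis Diff_insert0 Diff_empty)
    next
      case True
      have "Poly_Mapping.keys (merge (squarefree_exponent A)) \<in> G"
        using A finA unfolding GF by (auto simp: keys_squarefree_exponent)
      then have "collapse ` A \<in> G"
        by (simp add: keys_merge keys_squarefree_exponent finA)
      then have "Poly_Mapping.keys (squarefree_exponent (collapse ` A)) \<in> G"
        by (simp add: keys_squarefree_exponent finA)
      then obtain m where m: "Poly_Mapping.keys m \<in> F" "merge m = squarefree_exponent (collapse ` A)"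
        unfolding GF by auto
      have cA: "collapse ` A = insert 1 (A - {0})"
        using True unfolding collapse_image by auto
      have l: "Poly_Mapping.lookup (merge m) j = (if j = 1 \<or> j \<in> A \<and> j \<noteq> 0 then 1 else 0)" for j
        using finA by (simp add: m(2) lookup_squarefree_exponent cA)
      have "Poly_Mapping.lookup m 0 + Poly_Mapping.lookup m 1 = 1"
        using l[of 1] by (simp add: lookup_merge)
      then have "(0 \<notin> Poly_Mapping.keys m \<or> 1 \<notin> Poly_Mapping.keys m)"
        by (auto simp: in_keys_iff)
      moreover have "Poly_Mapping.keys m \<subseteq> A"
      proof
        fix j assume "j \<in> Poly_Mapping.keys m"
        then show "j \<in> A"
          using l[of j] True by (auto simp: lookup_merge in_keys_iff split: if_splits)
      qed
      ultimately show ?thesis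
        using up_closedD[OF F m(1)] up_closed_subset[OF F A] by (metis Diff_subset order_trans subset_Diff_insert Diff_empty)
    qed
  qed
qed

text \<open>For a set of the remaining variables containing the merged one, membership on the left says that
  one of two sets, each obtained from the complement by adding \<open>0\<close> or \<open>1\<close>, is outside \<open>F\<close>; the
  condition on facets turns this into the complement being outside. For a set without the merged
  variable, the condition on generators plays this role.\<close>

lemma collapse_dual_family:
  assumes n: "n \<ge> 1" and F: "up_closed {0..n} F"
    and omit: "generators_omit 0 1 F" and meet: "facets_meet 0 1 F"
  shows "collapse_family (dual_family {0..n} F) = dual_family {1..n} (collapse_family F)"
proof -
  let ?V = "{0..n}" and ?W = "{1..n}"
  have dual: "up_closed ?V (dual_family ?V F)" "generators_omit 0 1 (dual_family ?V F)"
    using meet n by (simp_all add: up_closed_dual_family[OF F] generators_omit_dual_family_iff[OF F])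
  have "B \<in> collapse_family (dual_family ?V F) \<longleftrightarrow> ?W - B \<notin> collapse_family F" if B: "B \<subseteq> ?W" for B
  proof -
    have 0: "0 \<notin> B" "0 \<notin> ?W - B" using B by auto
    have "B \<subseteq> ?V" "insert 0 (B - {1}) \<subseteq> ?V" using B by auto
    then have L: "B \<in> collapse_family (dual_family ?V F) \<longleftrightarrow>
        ?V - B \<notin> F \<or> 1 \<in> B \<and> ?V - insert 0 (B - {1}) \<notin> F"
      unfolding mem_collapse_family_iff[OF dual(2) 0(1)] unfolding dual_family_def
      by (simp only: mem_Collect_eq simp_thms)
    have R: "?W - B \<in> collapse_family F \<longleftrightarrow>
        ?W - B \<in> F \<or> 1 \<in> ?W - B \<and> insert 0 (?W - B - {1}) \<in> F"
      by (rule mem_collapse_family_iff[OF omit 0(2)])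
    have V: "?V = insert 0 ?W" by auto
    show ?thesis
    proof (cases "1 \<in> B")
      case True
      let ?C = "?W - B"
      have e: "?V - B = insert 0 ?C" "?V - insert 0 (B - {1}) = insert 1 ?C"
        unfolding V using 0 True n by auto
      have iff: "?C \<in> F \<longleftrightarrow> insert 0 ?C \<in> F \<and> insert 1 ?C \<in> F"
      proof
        assume C: "?C \<in> F"
        have "insert 0 ?C \<subseteq> ?V" "insert 1 ?C \<subseteq> ?V" using n by auto
        then show "insert 0 ?C \<in> F \<and> insert 1 ?C \<in> F"
          by (intro conjI up_closedD[OF F C]) blast+
      qed (use meet in \<open>unfold facets_meet_def, blast\<close>)
      show ?thesis unfolding L R e using iff True by blast
    next
      case False
      let ?A = "?V - B"
      have e: "?A - {0} = ?W - B" "?A - {1} = insert 0 (?W - B - {1})"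
        unfolding V using 0 n False by auto
      have iff: "?A \<in> F \<longleftrightarrow> ?A - {0} \<in> F \<or> ?A - {1} \<in> F"
      proof
        assume "?A - {0} \<in> F \<or> ?A - {1} \<in> F"
        then show "?A \<in> F"
          using up_closedD[OF F, of "?A - {0}" ?A] up_closedD[OF F, of "?A - {1}" ?A] by blast
      qed (use omit in \<open>unfold generators_omit_def, blast\<close>)
      have "1 \<in> ?W - B" using False n by simp
      then show ?thesis unfolding L R using iff[unfolded e] False by blast
    qed
  qed
  moreover have "B \<subseteq> ?W" if "B \<in> collapse_family (dual_family ?V F)" for B
    using up_closed_collapse_family[OF n dual(1)] that by (rule up_closed_subset)
  ultimately show ?thesis by (auto simp: dual_family_def)
qed

section \<open>Alexander duality and the identification of two variables\<close>

theorem proposition7p2: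
  fixes n :: nat
    and S :: "'k::field mpoly ring"
    and I J I\<^sub>1 J\<^sub>1 :: "'k mpoly set"
  assumes n: "n \<ge> 1"
    and S: "S = mpoly_ring {0..n}"
    and I: "squarefree_monomial_ideal {0..n} I"
    and J: "J = alexander_dual {0..n} I"
    and I\<^sub>1: "I\<^sub>1 = identify01 ` I"
    and J\<^sub>1: "J\<^sub>1 = identify01 ` J"
  shows "(regular_element (S Quot I) (I +>\<^bsub>S\<^esub> (Var 1 - Var 0))
            \<longrightarrow> squarefree_monomial_ideal {1..n} J\<^sub>1)
       \<and> (squarefree_monomial_ideal {1..n} I\<^sub>1
            \<longrightarrow> regular_element (S Quot J) (J +>\<^bsub>S\<^esub> (Var 1 - Var 0)))
       \<and> (regular_element (S Quot I) (I +>\<^bsub>S\<^esub> (Var 1 - Var 0))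
            \<and> squarefree_monomial_ideal {1..n} I\<^sub>1
            \<longrightarrow> J\<^sub>1 = alexander_dual {1..n} I\<^sub>1)"
proof -
  obtain F where F: "up_closed {0..n} F" and IF: "I = support_ideal F"
    using I squarefree_monomial_ideal_iff by blast
  let ?G = "dual_family {0..n} F"
  have G: "up_closed {0..n} ?G" using F by (rule up_closed_dual_family)
  have JG: "J = support_ideal ?G"
    unfolding J IF by (rule alexander_dual_support_ideal[OF _ F]) simp
  have V: "0 \<in> {0..n}" "1 \<in> {0..n}" using n by auto
  have regI: "regular_element (S Quot I) (I +>\<^bsub>S\<^esub> (Var 1 - Var 0)) \<longleftrightarrow> facets_meet 0 1 F"
    unfolding S IF by (rule regular_difference_iff_facets_meet[OF _ F _ V]) auto
  have regJ: "regular_element (S Quot J) (J +>\<^bsub>S\<^esub> (Var 1 - Var 0)) \<longleftrightarrow> generators_omit 0 1 F"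
    unfolding S JG facets_meet_dual_family_iff[OF F V, symmetric]
    by (rule regular_difference_iff_facets_meet[OF _ G _ V]) auto
  have sqI: "squarefree_monomial_ideal {1..n} I\<^sub>1 \<longleftrightarrow> generators_omit 0 1 F"
    unfolding I\<^sub>1 IF by (rule squarefree_image_iff_generators_omit[OF n F])
  have sqJ: "squarefree_monomial_ideal {1..n} J\<^sub>1 \<longleftrightarrow> facets_meet 0 1 F"
    unfolding J\<^sub>1 JG generators_omit_dual_family_iff[OF F V, symmetric]
    by (rule squarefree_image_iff_generators_omit[OF n G])
  have "J\<^sub>1 = alexander_dual {1..n} I\<^sub>1" if meet: "facets_meet 0 1 F" and omit: "generators_omit 0 1 F"
  proof -
    have "J\<^sub>1 = support_ideal (collapse_family ?G)"
      unfolding J\<^sub>1 JG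
      using meet generators_omit_dual_family_iff[OF F V]
      by (intro image_support_ideal_eq_collapse) blast
    also have "\<dots> = support_ideal (dual_family {1..n} (collapse_family F))"
      by (simp only: collapse_dual_family[OF n F omit meet])
    also have "\<dots> = alexander_dual {1..n} (support_ideal (collapse_family F))"
      by (rule alexander_dual_support_ideal[OF _ up_closed_collapse_family[OF n F], symmetric]) simp
    also have "support_ideal (collapse_family F) = I\<^sub>1"
      unfolding I\<^sub>1 IF by (rule image_support_ideal_eq_collapse[OF omit, symmetric])
    finally show ?thesis .
  qed
  then show ?thesis
    unfolding regI regJ sqI sqJ by blast
qed

end
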